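(* The following statements hold for social choice rules $f$ with range $\Omega$: (i) Every SP rule $f$ with $\Omega=X$ is PE. (ii) Every SP rule $f$ with $\Omega\notin\{X,\{\min X,\max X\}\}$ is not PE (if $\min X$ or $\max X$ does not exist, the hypothesis just means $\Omega\ne X$). (iii) Let $f$ be an SP rule with $\Omega=\{\min X,\max X\}\ne X$ (so that $\min X$ and $\max X$ exist). Then $f$ is PE if and only if $A=\emptyset$ or $r_\omega=\{(\min X,\max X)\}$.
   Context: Model. $X\subseteq\mathbb{R}$ is a set of alternatives; $N=\{1,\dots,n\}$ is a finite set of agents partitioned into $A$ (with $|A|=a$, possibly $0$) and $D=N\setminus A$ (possibly empty). A preference $R_i$ is a complete, transitive, antisymmetric binary relation on $X$ with strict part $P_i$. For $i\in A$, $\mathcal{R}_i$ is the set of all single-peaked preferences: those for which there is $\rho(R_i)\in X$ such that for all $x,y\in X$, [$\rho(R_i)\ge x>y$ or $\rho(R_i)\le x<y$] implies $x\,P_i\,y$. For $i\in D$, $\mathcal{R}_i$ is the set of all single-dipped preferences: those for which there is $\delta(R_i)\in X$ such that for all $x,y\in X$, [$\delta(R_i)\ge x>y$ or $\delta(R_i)\le x<y$] implies $y\,P_i\,x$. $\mathcal{R}=\times_{i\in N}\mathcal{R}_i$. A social choice rule is a function $f:\mathcal{R}\to X$; $\Omega$ denotes its range. Standing assumptions: $\mathbb{R}\setminus\Omega$ is either empty or a union of open sets, and $|\Omega|\ge2$. $f$ is strategy-proof (SP) if there are no $i\in N$, $R\in\mathcal{R}$, $R'_i\in\mathcal{R}_i$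 with $f(R'_i,R_{-i})\,P_i\,f(R)$. $f$ is Pareto efficient (PE) if for each $R\in\mathcal{R}$ there is no $x\in X$ such that $x\,P_i\,f(R)$ for each $i\in N$. For $i\in A$, $p(R_i)$ is the best element of $\Omega$ under $R_i$; $p(R)=(p(R_i))_{i\in A}\in\Omega^a$ (for $a=0$, $\Omega^a$ contains only the empty vector). For $\mathbf{p}\in\Omega^a$, $\omega(\mathbf{p})=\Omega(\mathbf{p})=\{x\in\Omega:\exists R\in\mathcal{R},\ p(R)=\mathbf{p},\ f(R)=x\}$, where a singleton is identified with its element and a two-element set $\{x,y\}$, $x<y$, with the ordered pair $(x,y)$ (for SP rules $|\Omega(\mathbf{p})|\le2$). $r_\omega=\{\omega(\mathbf{p}):\mathbf{p}\in\Omega^a\}$ is the range of $\omega$. *)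

theory Defs
  imports "HOL-Analysis.Analysis"
begin

(* (x, y) \<in> r reads "x is weakly preferred to y"; note that linear_order_on X r
   includes r \<subseteq> X \<times> X as well as completeness, transitivity and antisymmetry. *)
type_synonym pref = "(real \<times> real) set"

definition strictly_prefers :: "pref \<Rightarrow> real \<Rightarrow> real \<Rightarrow> bool" where
  "strictly_prefers r x y \<longleftrightarrow> (x, y) \<in> r \<and> (y, x) \<notin> r"

definition single_peaked_prefs :: "real set \<Rightarrow> pref set" where
  "single_peaked_prefs X = {r. linear_order_on X r \<and>
     (\<exists>\<rho>\<in>X. \<forall>x\<in>X. \<forall>y\<in>X. (\<rho> \<ge> x \<and> x > y) \<or> (\<rho> \<le> x \<and> x < y) \<longrightarrow> strictly_prefers r x y)}"

definition single_dipped_prefs :: "real set \<Rightarrow> pref set" where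
  "single_dipped_prefs X = {r. linear_order_on X r \<and>
     (\<exists>\<delta>\<in>X. \<forall>x\<in>X. \<forall>y\<in>X. (\<delta> \<ge> x \<and> x > y) \<or> (\<delta> \<le> x \<and> x < y) \<longrightarrow> strictly_prefers r y x)}"

(* A is the set of agents with single-peaked preferences; D is the complement of A in N. *)
definition admissible_prefs :: "real set \<Rightarrow> nat set \<Rightarrow> nat \<Rightarrow> pref set" where
  "admissible_prefs X A i = (if i \<in> A then single_peaked_prefs X else single_dipped_prefs X)"

definition profiles :: "real set \<Rightarrow> nat \<Rightarrow> nat set \<Rightarrow> (nat \<Rightarrow> pref) set" where
  "profiles X n A = (\<Pi>\<^sub>E i\<in>{1..n}. admissible_prefs X A i)"

definition rule_range :: "real set \<Rightarrow> nat \<Rightarrow> nat set \<Rightarrow> ((nat \<Rightarrow> pref) \<Rightarrow> real) \<Rightarrow> real set" where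
  "rule_range X n A f = f ` profiles X n A"

(* Includes the standing assumptions on the range: its complement is open (possibly empty), and
   it has at least two elements, not phrased with card, which is 0 on infinite sets. *)
definition social_choice_rule :: "real set \<Rightarrow> nat \<Rightarrow> nat set \<Rightarrow> ((nat \<Rightarrow> pref) \<Rightarrow> real) \<Rightarrow> bool" where
  "social_choice_rule X n A f \<longleftrightarrow>
     f \<in> profiles X n A \<rightarrow> X \<and>
     open (UNIV - rule_range X n A f) \<and>
     (\<exists>x\<in>rule_range X n A f. \<exists>y\<in>rule_range X n A f. x \<noteq> y)"

definition strategy_proof :: "real set \<Rightarrow> nat \<Rightarrow> nat set \<Rightarrow> ((nat \<Rightarrow> pref) \<Rightarrow> real) \<Rightarrow> bool" where
  "strategy_proof X n A f \<longleftrightarrow>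
     \<not> (\<exists>i\<in>{1..n}. \<exists>R\<in>profiles X n A. \<exists>r'\<in>admissible_prefs X A i.
          strictly_prefers (R i) (f (R(i := r'))) (f R))"

definition pareto_efficient :: "real set \<Rightarrow> nat \<Rightarrow> nat set \<Rightarrow> ((nat \<Rightarrow> pref) \<Rightarrow> real) \<Rightarrow> bool" where
  "pareto_efficient X n A f \<longleftrightarrow>
     (\<forall>R\<in>profiles X n A. \<not> (\<exists>x\<in>X. \<forall>i\<in>{1..n}. strictly_prefers (R i) x (f R)))"

(* For r single-peaked on X and S a nonempty closed subset of X, the best element of S
   exists and is unique, so the description is proper. *)
definition best_in :: "real set \<Rightarrow> pref \<Rightarrow> real" where
  "best_in S r = (THE x. x \<in> S \<and> (\<forall>y\<in>S. (x, y) \<in> r))"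

definition peak_vector ::
  "real set \<Rightarrow> nat \<Rightarrow> nat set \<Rightarrow> ((nat \<Rightarrow> pref) \<Rightarrow> real) \<Rightarrow> (nat \<Rightarrow> pref) \<Rightarrow> nat \<Rightarrow> real" where
  "peak_vector X n A f R = (\<lambda>i\<in>A. best_in (rule_range X n A f) (R i))"

(* omega returns the set of outcomes compatible with a peak vector; a singleton {x} stands
   for x, and a two-element set {x, y} with x < y for the ordered pair (x, y). *)
definition omega ::
  "real set \<Rightarrow> nat \<Rightarrow> nat set \<Rightarrow> ((nat \<Rightarrow> pref) \<Rightarrow> real) \<Rightarrow> (nat \<Rightarrow> real) \<Rightarrow> real set" where
  "omega X n A f p = {x \<in> rule_range X n A f.
     \<exists>R\<in>profiles X n A. peak_vector X n A f R = p \<and> f R = x}"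

definition range_omega ::
  "real set \<Rightarrow> nat \<Rightarrow> nat set \<Rightarrow> ((nat \<Rightarrow> pref) \<Rightarrow> real) \<Rightarrow> real set set" where
  "range_omega X n A f = omega X n A f ` (A \<rightarrow>\<^sub>E rule_range X n A f)"

definition is_min :: "real set \<Rightarrow> real \<Rightarrow> bool" where
  "is_min X m \<longleftrightarrow> m \<in> X \<and> (\<forall>x\<in>X. m \<le> x)"

definition is_max :: "real set \<Rightarrow> real \<Rightarrow> bool" where
  "is_max X m \<longleftrightarrow> m \<in> X \<and> (\<forall>x\<in>X. x \<le> m)"

end

theory Submission
  imports Defs
begin

text \<open>The engine is group strategy-proofness for coalitions consisting only of peaked or only of
  dipped agents. If everyone prefers \<open>x\<close> to the outcome \<open>y\<close>, move the peaked agents to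
  preferences with peak \<open>x\<close> that rank the side of \<open>y\<close> first: this keeps \<open>y\<close>, while at
  any profile with outcome \<open>x\<close> the same move keeps \<open>x\<close>, so the dipped agents alone could
  jump from \<open>y\<close> to \<open>x\<close>. If the range omits \<open>x\<close>, efficiency at profiles where all
  peaked agents have peak \<open>x\<close> forces the outcome to be one the dipped agents want. When there are two
  elements of the range on the same side of \<open>x\<close>, the dipped agents can then reach outcomes on both
  sides of the nearer one as well as that one itself, which is impossible because an option set of
  dipped agents has no interior point. So the range is \<open>{min X, max X}\<close>, where an intermediate
  peak lets the dipped agents decide whatever the peaks in the range are.\<close>

section \<open>Single-peaked and single-dipped preferences\<close>

lemma linear_strictly_prefers:
  assumes "linear_order_on X r"
  shows "strictly_prefers r x y \<longleftrightarrow> (x, y) \<in> r \<and> x \<noteq> y"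
  using assms
  by (auto simp: strictly_prefers_def linear_order_on_def partial_order_on_def preorder_on_def
      antisym_def refl_on_def)

lemma linear_strictly_prefers_total:
  assumes "linear_order_on X r" "x \<in> X" "y \<in> X" "x \<noteq> y"
  shows "strictly_prefers r x y \<or> strictly_prefers r y x"
  using assms linear_strictly_prefers[OF assms(1)]
  by (auto simp: linear_order_on_def total_on_def)

lemma strictly_prefers_trans:
  assumes "linear_order_on X r" "strictly_prefers r x y" "strictly_prefers r y z"
  shows "strictly_prefers r x z"
  using assms(2,3) assms(1)
  unfolding strictly_prefers_def linear_order_on_def partial_order_on_def preorder_on_def trans_def
  by blast

lemma strictly_prefers_asym: "strictly_prefers r x y \<Longrightarrow> \<not> strictly_prefers r y x"
  by (auto simp: strictly_prefers_def)

text \<open>The middle point \<open>v\<close> lies weakly on one side of the dip, so the outer point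
  further out on that side beats it: \<open>v\<close> is never the best of the three.\<close>

lemma single_dipped_middle:
  assumes "r \<in> single_dipped_prefs X" "u \<in> X" "v \<in> X" "w \<in> X"
    and "u < v \<and> v < w \<or> w < v \<and> v < u" and "strictly_prefers r v u"
  shows "\<not> strictly_prefers r v w"
proof -
  obtain \<delta> where \<delta>: "\<And>x y. x \<in> X \<Longrightarrow> y \<in> X \<Longrightarrow> (\<delta> \<ge> x \<and> x > y) \<or> (\<delta> \<le> x \<and> x < y) \<Longrightarrow>
      strictly_prefers r y x"
    using assms(1) unfolding single_dipped_prefs_def by blast
  show ?thesis
    using \<delta>[of v u] \<delta>[of v w] assms strictly_prefers_asym[of r v u]
      strictly_prefers_asym[of r v w] by linarith
qed

text \<open>The middle point lies weakly on one side of the peak and beats the outer point further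
  out on that side, so it is never the worst of the three.\<close>

lemma single_peaked_middle:
  assumes "r \<in> single_peaked_prefs X" "u \<in> X" "v \<in> X" "w \<in> X"
    and "u < v \<and> v < w \<or> w < v \<and> v < u" and "strictly_prefers r u v"
  shows "\<not> strictly_prefers r w v"
proof -
  obtain \<rho> where \<rho>: "\<And>x y. x \<in> X \<Longrightarrow> y \<in> X \<Longrightarrow> (\<rho> \<ge> x \<and> x > y) \<or> (\<rho> \<le> x \<and> x < y) \<Longrightarrow>
      strictly_prefers r x y"
    using assms(1) unfolding single_peaked_prefs_def by blast
  show ?thesis
    using \<rho>[of v u] \<rho>[of v w] assms strictly_prefers_asym[of r u v]
      strictly_prefers_asym[of r w v] by linarith
qed

section \<open>Explicit preferences with prescribed dip or peak\<close>

definition key_pref :: "real set \<Rightarrow> (real \<Rightarrow> real) \<Rightarrow> pref" where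
  "key_pref X k = {(u, v). u \<in> X \<and> v \<in> X \<and> k v \<le> k u}"

lemma linear_key_pref: "inj_on k X \<Longrightarrow> linear_order_on X (key_pref X k)"
  by (auto simp: key_pref_def linear_order_on_def partial_order_on_def preorder_on_def refl_on_def
      trans_def antisym_def total_on_def inj_on_def)

lemma strictly_prefers_key:
  "strictly_prefers (key_pref X k) u v \<longleftrightarrow> u \<in> X \<and> v \<in> X \<and> k v < k u"
  by (auto simp: strictly_prefers_def key_pref_def)

text \<open>The values on the negative half-line stay below 1, so every positive number is ranked above
  every nonpositive one, even if \<^term>\<open>X\<close> is unbounded.\<close>

definition skew :: "real \<Rightarrow> real" where
  "skew t = (if 0 < t then 1 + t else - t / (1 - t))"

lemma skew_less_iff: "skew a < skew b \<longleftrightarrow> (0 < b \<and> a < b) \<or> (a \<le> 0 \<and> b < a)"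
proof -
  have *: "- t / (1 - t) < 1" "- t / (1 - t) \<ge> 0" if "t \<le> 0" for t :: real
    using that by (auto simp: field_simps divide_nonneg_nonneg)
  have **: "- a / (1 - a) < - b / (1 - b) \<longleftrightarrow> b < a" if "a \<le> 0" "b \<le> 0"
    using that by (simp add: field_simps)
  show ?thesis
    using *[of a] *[of b] ** unfolding skew_def by (auto split: if_splits)
qed

lemma inj_skew: "inj skew"
proof (rule injI)
  fix a b assume "skew a = skew b"
  then show "a = b" using skew_less_iff[of a b] skew_less_iff[of b a] by linarith
qed

text \<open>For \<^term>\<open>s = 1\<close> everything above \<^term>\<open>c\<close> is preferred to everything below it, for
  \<^term>\<open>s = - 1\<close> it is the other way round.\<close>

definition dip_pref :: "real set \<Rightarrow> real \<Rightarrow> real \<Rightarrow> pref" where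
  "dip_pref X s c = key_pref X (\<lambda>z. skew (s * (z - c)))"

definition peak_pref :: "real set \<Rightarrow> real \<Rightarrow> real \<Rightarrow> pref" where
  "peak_pref X s c = key_pref X (\<lambda>z. - skew (s * (c - z)))"

text \<open>In the first case the better point lies strictly beyond \<open>c\<close> in direction
  \<open>s\<close>, in the second both points lie weakly behind \<open>c\<close>. Multiplying by
  \<open>s\<close> treats both orientations at once.\<close>

lemma strictly_prefers_dip:
  "strictly_prefers (dip_pref X s c) u v \<longleftrightarrow>
     u \<in> X \<and> v \<in> X \<and> ((s * c < s * u \<and> s * v < s * u) \<or> (s * v \<le> s * c \<and> s * u < s * v))"
  unfolding dip_pref_def strictly_prefers_key skew_less_iff by (auto simp: algebra_simps)

lemma strictly_prefers_peak:
  "strictly_prefers (peak_pref X s c) u v \<longleftrightarrow>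
     u \<in> X \<and> v \<in> X \<and> ((s * v < s * c \<and> s * v < s * u) \<or> (s * c \<le> s * u \<and> s * u < s * v))"
  unfolding peak_pref_def strictly_prefers_key neg_less_iff_less skew_less_iff
  by (auto simp: algebra_simps)

lemma dip_pref_single_dipped:
  assumes "s = 1 \<or> s = - 1" "c \<in> X"
  shows "dip_pref X s c \<in> single_dipped_prefs X"
proof -
  have "linear_order_on X (dip_pref X s c)"
    unfolding dip_pref_def using assms(1)
    by (intro linear_key_pref inj_onI) (auto dest!: injD[OF inj_skew])
  moreover have "\<forall>x\<in>X. \<forall>y\<in>X. (c \<ge> x \<and> x > y) \<or> (c \<le> x \<and> x < y) \<longrightarrow>
      strictly_prefers (dip_pref X s c) y x"
    using assms(1) by (auto simp: strictly_prefers_dip)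
  ultimately show ?thesis
    using assms(2) unfolding single_dipped_prefs_def by blast
qed

lemma peak_pref_single_peaked:
  assumes "s = 1 \<or> s = - 1" "c \<in> X"
  shows "peak_pref X s c \<in> single_peaked_prefs X"
proof -
  have "linear_order_on X (peak_pref X s c)"
    unfolding peak_pref_def using assms(1)
    by (intro linear_key_pref inj_onI) (auto dest!: injD[OF inj_skew])
  moreover have "\<forall>x\<in>X. \<forall>y\<in>X. (c \<ge> x \<and> x > y) \<or> (c \<le> x \<and> x < y) \<longrightarrow>
      strictly_prefers (peak_pref X s c) x y"
    using assms(1) by (auto simp: strictly_prefers_peak)
  ultimately show ?thesis
    using assms(2) unfolding single_peaked_prefs_def by blast
qed

section \<open>Group strategy-proofness\<close>

lemma admissible_linear: "r \<in> admissible_prefs X A i \<Longrightarrow> linear_order_on X r"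
  by (auto simp: admissible_prefs_def single_peaked_prefs_def single_dipped_prefs_def split: if_splits)

lemma profiles_admissible: "R \<in> profiles X n A \<Longrightarrow> i \<in> {1..n} \<Longrightarrow> R i \<in> admissible_prefs X A i"
  by (auto simp: profiles_def)

lemma profiles_peaked: "R \<in> profiles X n A \<Longrightarrow> i \<in> {1..n} \<inter> A \<Longrightarrow> R i \<in> single_peaked_prefs X"
  using profiles_admissible[of R X n A i] by (simp add: admissible_prefs_def)

lemma profiles_dipped: "R \<in> profiles X n A \<Longrightarrow> i \<in> {1..n} - A \<Longrightarrow> R i \<in> single_dipped_prefs X"
  using profiles_admissible[of R X n A i] by (simp add: admissible_prefs_def)

lemma profiles_update:
  "R \<in> profiles X n A \<Longrightarrow> i \<in> {1..n} \<Longrightarrow> r \<in> admissible_prefs X A i \<Longrightarrow> R(i := r) \<in> profiles X n A"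
  unfolding profiles_def by (auto simp: PiE_iff extensional_def)

lemma profiles_eqI:
  "R \<in> profiles X n A \<Longrightarrow> R' \<in> profiles X n A \<Longrightarrow> (\<And>i. i \<in> {1..n} \<Longrightarrow> R i = R' i) \<Longrightarrow> R = R'"
  unfolding profiles_def by (rule PiE_ext)

locale sp_rule =
  fixes X :: "real set" and n :: nat and A :: "nat set" and f :: "(nat \<Rightarrow> pref) \<Rightarrow> real"
  assumes outcome_in: "R \<in> profiles X n A \<Longrightarrow> f R \<in> X"
    and strategy_proof: "strategy_proof X n A f"
begin

lemma no_manipulation:
  "R \<in> profiles X n A \<Longrightarrow> i \<in> {1..n} \<Longrightarrow> r \<in> admissible_prefs X A i \<Longrightarrow>
     \<not> strictly_prefers (R i) (f (R(i := r))) (f R)"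
  using strategy_proof unfolding strategy_proof_def by blast

lemma linear: "R \<in> profiles X n A \<Longrightarrow> i \<in> {1..n} \<Longrightarrow> linear_order_on X (R i)"
  using admissible_linear profiles_admissible by blast

text \<open>Suppose all members of \<open>C\<close> prefer the target \<open>x\<close> to \<open>y\<close>. For \<^term>\<open>i \<in> C\<close>
  let \<open>z i\<close> be the outcome after the deviation of \<open>i\<close> alone. By induction some
  \<open>j\<close> ranks \<open>z i\<close> above \<open>x\<close>; the shapes of the preferences then
  force \<open>z j\<close> to be strictly further than \<open>z i\<close> in the direction from \<open>y\<close> to
  \<open>x\<close>. As \<open>C\<close> is finite, this cannot go on forever.\<close>

lemma group_strategy_proof:
  assumes "R \<in> profiles X n A" "R' \<in> profiles X n A" "C \<subseteq> {1..n}" "C \<subseteq> A \<or> C \<inter> A = {}"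
    and "\<And>i. i \<in> {1..n} - C \<Longrightarrow> R i = R' i" and "f R \<noteq> f R'"
  shows "\<exists>j\<in>C. strictly_prefers (R j) (f R) (f R')"
  using assms
proof (induction "card C" arbitrary: C R rule: less_induct)
  case less
  note R = less.prems(1) and R' = less.prems(2) and C = less.prems(3) and type = less.prems(4)
    and agree = less.prems(5)
  have fin: "finite C" using C finite_subset by blast
  define x y where "x = f R'" and "y = f R"
  have xX: "x \<in> X" and yX: "y \<in> X" using R R' outcome_in by (auto simp: x_def y_def)
  have xy: "x \<noteq> y" using less.prems(6) by (simp add: x_def y_def)
  show ?case
  proof (rule ccontr)
    assume "\<not> ?thesis"
    then have xPy: "strictly_prefers (R j) x y" if "j \<in> C" for j
      using linear_strictly_prefers_total[OF linear[OF R] xX yX xy] that C unfolding x_def y_def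
      by blast
    define z where "z i = f (R(i := R' i))" for i
    have upd: "R(i := R' i) \<in> profiles X n A" if "i \<in> C" for i
      using that C R profiles_admissible[OF R'] by (blast intro: profiles_update)
    have zX: "z i \<in> X" if "i \<in> C" for i
      using outcome_in[OF upd[OF that]] by (simp add: z_def)
    have sp: "\<not> strictly_prefers (R i) (z i) y" if "i \<in> C" for i
      using no_manipulation[OF R] profiles_admissible[OF R'] that C unfolding z_def y_def by blast
    have zx: "z i \<noteq> x" if "i \<in> C" for i
      using sp[OF that] xPy[OF that] by auto
    have step: "\<exists>j\<in>C. strictly_prefers (R j) (z i) x" if i: "i \<in> C" for i
    proof -
      have "\<exists>j\<in>C - {i}. strictly_prefers ((R(i := R' i)) j) (f (R(i := R' i))) (f R')"
      proof (rule less.hyps[OF _ upd[OF i] R'])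
        show "card (C - {i}) < card C" using i fin by (meson card_Diff1_less)
        show "C - {i} \<subseteq> {1..n}" using C by blast
        show "C - {i} \<subseteq> A \<or> (C - {i}) \<inter> A = {}" using type by blast
        show "(R(i := R' i)) k = R' k" if "k \<in> {1..n} - (C - {i})" for k
          using that agree[of k] by auto
        show "f (R(i := R' i)) \<noteq> f R'" using zx[OF i] by (simp add: z_def x_def)
      qed
      then show ?thesis by (auto simp: z_def x_def)
    qed
    have zPy: "strictly_prefers (R j) (z i) y" if "j \<in> C" "strictly_prefers (R j) (z i) x" for i j
      using that(2) xPy[OF that(1)] strictly_prefers_trans linear[OF R] C that(1) by blast
    have zy: "z i \<noteq> y" if "i \<in> C" for i
      using step[OF that] zPy by (auto simp: strictly_prefers_def)
    have yPz: "strictly_prefers (R i) y (z i)" if "i \<in> C" for i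
      using linear_strictly_prefers_total[OF linear[OF R] yX zX zy[symmetric]] sp that C by blast
    have xPz: "strictly_prefers (R i) x (z i)" if "i \<in> C" for i
      using strictly_prefers_trans[OF linear[OF R] xPy yPz] that C by blast
    have zPz: "strictly_prefers (R j) (z i) (z j)" if "j \<in> C" "strictly_prefers (R j) (z i) x" for i j
      using that(2) xPz[OF that(1)] strictly_prefers_trans linear[OF R] C that(1) by blast
    \<comment> \<open>The orientation from \<open>y\<close> to \<open>x\<close>: after
      multiplication by \<open>s\<close>, \<open>y\<close> comes before \<open>x\<close>.\<close>
    define s :: real where "s = sgn (x - y)"
    have s: "s = 1 \<or> s = - 1" and sxy: "s * y < s * x"
      using xy by (auto simp: s_def sgn_if)
    have between: "u < v \<and> v < w \<or> w < v \<and> v < u"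
      if "s * u < s * v \<and> s * v < s * w \<or> s * w < s * v \<and> s * v < s * u" for u v w
      using s that by auto
    have neq: "s * u \<noteq> s * v" if "u \<noteq> v" for u v using s that by auto
    have progress: "s * z i < s * z j"
      if i: "i \<in> C" and j: "j \<in> C" and ij: "strictly_prefers (R j) (z i) x" for i j
    proof (cases "C \<subseteq> A")
      case True
      then have pk: "R k \<in> single_peaked_prefs X" if "k \<in> C" for k
        using profiles_peaked[OF R] that C by blast
      note mid = single_peaked_middle[OF pk _ _ _ between]
      \<comment> \<open>Were \<open>z k\<close> behind \<open>y\<close>, then \<open>y\<close> would
        be a middle point that \<open>l\<close> ranks last; between \<open>y\<close> and
        \<open>x\<close>, \<open>z k\<close> would be a middle point that \<open>k\<close> ranks
        last.\<close>
      have high: "s * x < s * z k" if k: "k \<in> C" for k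
      proof -
        obtain l where l: "l \<in> C" "strictly_prefers (R l) (z k) x" using step[OF k] by blast
        have "\<not> s * z k < s * y"
          using mid[OF l(1), of "z k" y x] sxy zX[OF k] yX xX zPy[OF l] xPy[OF l(1)] by blast
        moreover have "\<not> (s * y < s * z k \<and> s * z k < s * x)"
          using mid[OF k, of x "z k" y] zX[OF k] yX xX xPz[OF k] yPz[OF k] by blast
        ultimately show ?thesis using neq[OF zx[OF k]] neq[OF zy[OF k]] by linarith
      qed
      \<comment> \<open>Since \<open>z j\<close> lies beyond \<open>x\<close>, a \<open>z i\<close>
        still further out would make \<open>z j\<close> a middle point that \<open>j\<close> ranks
        last.\<close>
      have "\<not> s * z j < s * z i"
        using mid[OF j, of "z i" "z j" x] high[OF j] zX i j xX zPz[OF j ij] xPz[OF j] by blast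
      moreover have "z i \<noteq> z j" using zPz[OF j ij] by (auto simp: strictly_prefers_def)
      ultimately show ?thesis using neq[of "z i" "z j"] by linarith
    next
      case False
      then have dp: "R k \<in> single_dipped_prefs X" if "k \<in> C" for k
        using profiles_dipped[OF R] that C type by blast
      note mid = single_dipped_middle[OF dp _ _ _ between]
      \<comment> \<open>Were \<open>z k\<close> beyond \<open>x\<close>, then \<open>x\<close> would
        be a middle point that \<open>k\<close> ranks first; between \<open>y\<close> and
        \<open>x\<close>, \<open>z k\<close> would be a middle point that \<open>l\<close> ranks
        first.\<close>
      have low: "s * z k < s * y" if k: "k \<in> C" for k
      proof -
        obtain l where l: "l \<in> C" "strictly_prefers (R l) (z k) x" using step[OF k] by blast
        have "\<not> s * x < s * z k"
          using mid[OF k, of y x "z k"] sxy zX[OF k] yX xX xPy[OF k] xPz[OF k] by blast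
        moreover have "\<not> (s * y < s * z k \<and> s * z k < s * x)"
          using mid[OF l(1), of x "z k" y] zX[OF k] yX xX l(2) zPy[OF l] by blast
        ultimately show ?thesis using neq[OF zx[OF k]] neq[OF zy[OF k]] by linarith
      qed
      \<comment> \<open>Otherwise \<open>z i\<close> would lie between \<open>z j\<close> and
        \<open>y\<close> and be the best of the three for \<open>j\<close>.\<close>
      have "\<not> s * z j < s * z i"
        using mid[OF j, of "z j" "z i" y] low[OF i] zX i j yX zPz[OF j ij] zPy[OF j ij] by blast
      moreover have "z i \<noteq> z j" using zPz[OF j ij] by (auto simp: strictly_prefers_def)
      ultimately show ?thesis using neq[of "z i" "z j"] by linarith
    qed
    have "C \<noteq> {}" using agree profiles_eqI[OF R R'] less.prems(6) by blast
    then have "Max ((\<lambda>i. s * z i) ` C) \<in> (\<lambda>i. s * z i) ` C"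
      using fin by (intro Max_in) auto
    then obtain i where i: "i \<in> C" and "Max ((\<lambda>i. s * z i) ` C) = s * z i" by blast
    then have max: "s * z k \<le> s * z i" if "k \<in> C" for k
      using fin that by (metis Max_ge finite_imageI imageI)
    obtain j where j: "j \<in> C" "strictly_prefers (R j) (z i) x" using step[OF i] by blast
    then show False using progress[OF i j] max[OF j(1)] by linarith
  qed
qed

text \<open>Group strategy-proofness yields some member of the block who loses by the move; as all
  members hold \<open>q\<close>, the block acts like one agent with preference
  \<open>q\<close>.\<close>

lemma common_pref_coalition:
  assumes "R \<in> profiles X n A" "R' \<in> profiles X n A" "C \<subseteq> A \<or> C \<inter> A = {}"
    and "\<And>i. i \<in> {1..n} - C \<Longrightarrow> R i = R' i"
    and "\<And>i. i \<in> {1..n} \<inter> C \<Longrightarrow> R i = q" and "f R \<noteq> f R'"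
  shows "strictly_prefers q (f R) (f R')"
proof -
  have "\<exists>j\<in>{1..n} \<inter> C. strictly_prefers (R j) (f R) (f R')"
  proof (rule group_strategy_proof[OF assms(1,2) _ _ _ assms(6)])
    show "{1..n} \<inter> C \<subseteq> A \<or> {1..n} \<inter> C \<inter> A = {}" using assms(3) by blast
    show "R i = R' i" if "i \<in> {1..n} - {1..n} \<inter> C" for i
      by (rule assms(4)) (use that in blast)
  qed blast
  then obtain j where "j \<in> {1..n} \<inter> C" "strictly_prefers (R j) (f R) (f R')" by blast
  then show ?thesis using assms(5)[of j] by simp
qed

end

section \<open>Profiles assembled from a peaked and a dipped half\<close>

definition peaked_part :: "real set \<Rightarrow> nat \<Rightarrow> nat set \<Rightarrow> (nat \<Rightarrow> pref) \<Rightarrow> bool" where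
  "peaked_part X n A Q \<longleftrightarrow> (\<forall>i\<in>{1..n} \<inter> A. Q i \<in> single_peaked_prefs X)"

definition dipped_part :: "real set \<Rightarrow> nat \<Rightarrow> nat set \<Rightarrow> (nat \<Rightarrow> pref) \<Rightarrow> bool" where
  "dipped_part X n A R \<longleftrightarrow> (\<forall>i\<in>{1..n} - A. R i \<in> single_dipped_prefs X)"

text \<open>Exchanging \<open>Q\<close> or \<open>R\<close> as a whole is a joint move of one side
  only, hence of a coalition covered by group strategy-proofness. The restriction supplies the value
  \<open>undefined\<close> outside \<open>{1..n}\<close> that \<open>profiles\<close>
  demands.\<close>

definition split_profile :: "nat \<Rightarrow> nat set \<Rightarrow> (nat \<Rightarrow> pref) \<Rightarrow> (nat \<Rightarrow> pref) \<Rightarrow> nat \<Rightarrow> pref" where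
  "split_profile n A Q R = (\<lambda>i\<in>{1..n}. if i \<in> A then Q i else R i)"

lemma peaked_part_profile: "R \<in> profiles X n A \<Longrightarrow> peaked_part X n A R"
  unfolding peaked_part_def using profiles_peaked by blast

lemma dipped_part_profile: "R \<in> profiles X n A \<Longrightarrow> dipped_part X n A R"
  unfolding dipped_part_def using profiles_dipped by blast

lemma peaked_part_const: "q \<in> single_peaked_prefs X \<Longrightarrow> peaked_part X n A (\<lambda>_. q)"
  by (simp add: peaked_part_def)

lemma dipped_part_const: "q \<in> single_dipped_prefs X \<Longrightarrow> dipped_part X n A (\<lambda>_. q)"
  by (simp add: dipped_part_def)

lemma split_profile_apply:
  "i \<in> {1..n} \<Longrightarrow> split_profile n A Q R i = (if i \<in> A then Q i else R i)"
  by (simp add: split_profile_def)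

lemma split_profile_in:
  assumes "peaked_part X n A Q" "dipped_part X n A R"
  shows "split_profile n A Q R \<in> profiles X n A"
  unfolding profiles_def
proof (rule PiE_I)
  fix i assume "i \<in> {1..n}"
  then show "split_profile n A Q R i \<in> admissible_prefs X A i"
    using assms by (cases "i \<in> A")
      (simp_all add: split_profile_apply admissible_prefs_def peaked_part_def dipped_part_def)
next
  fix i assume "i \<notin> {1..n}"
  then show "split_profile n A Q R i = undefined"
    unfolding split_profile_def by (simp only: restrict_apply if_False)
qed

lemma split_profile_self: "R \<in> profiles X n A \<Longrightarrow> split_profile n A R R = R"
  by (rule profiles_eqI[OF split_profile_in])
    (simp_all add: peaked_part_profile dipped_part_profile split_profile_apply)

context sp_rule
begin

lemma peaked_switch_from:
  assumes "peaked_part X n A Q" "peaked_part X n A Q'" "dipped_part X n A R"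
    and "f (split_profile n A Q R) \<noteq> f (split_profile n A Q' R)"
  shows "\<exists>j\<in>{1..n} \<inter> A. strictly_prefers (Q j) (f (split_profile n A Q R)) (f (split_profile n A Q' R))"
proof -
  have "\<exists>j\<in>{1..n} \<inter> A. strictly_prefers (split_profile n A Q R j)
      (f (split_profile n A Q R)) (f (split_profile n A Q' R))"
    by (rule group_strategy_proof[OF split_profile_in split_profile_in _ _ _ assms(4)])
      (simp_all add: assms split_profile_apply)
  then show ?thesis by (auto simp: split_profile_apply)
qed

lemma dipped_switch_from:
  assumes "peaked_part X n A Q" "dipped_part X n A R" "dipped_part X n A R'"
    and "f (split_profile n A Q R) \<noteq> f (split_profile n A Q R')"
  shows "\<exists>j\<in>{1..n} - A. strictly_prefers (R j) (f (split_profile n A Q R)) (f (split_profile n A Q R'))"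
proof -
  have "\<exists>j\<in>{1..n} - A. strictly_prefers (split_profile n A Q R j)
      (f (split_profile n A Q R)) (f (split_profile n A Q R'))"
  proof (rule group_strategy_proof[OF split_profile_in split_profile_in _ _ _ assms(4)])
    show "{1..n} - A \<subseteq> A \<or> ({1..n} - A) \<inter> A = {}" by blast
  qed (auto simp: assms split_profile_apply)
  then show ?thesis by (auto simp: split_profile_apply)
qed

section \<open>Onto rules\<close>

lemma pareto_efficient_if_onto:
  assumes onto: "rule_range X n A f = X" and two: "\<exists>x\<in>X. \<exists>y\<in>X. x \<noteq> y"
  shows "pareto_efficient X n A f"
  unfolding pareto_efficient_def
proof (rule ballI, rule notI)
  fix R assume R: "R \<in> profiles X n A"
    and "\<exists>x\<in>X. \<forall>i\<in>{1..n}. strictly_prefers (R i) x (f R)"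
  then obtain x where xX: "x \<in> X" and pref: "\<forall>i\<in>{1..n}. strictly_prefers (R i) x (f R)" by blast
  have "x \<in> f ` profiles X n A" using xX onto by (simp only: rule_range_def)
  then obtain R' where R': "R' \<in> profiles X n A" "f R' = x" by (elim imageE) simp
  note parts = peaked_part_profile[OF R] dipped_part_profile[OF R]
    peaked_part_profile[OF R'(1)] dipped_part_profile[OF R'(1)]
  have yX: "f R \<in> X" using outcome_in[OF R] .
  \<comment> \<open>With no agents the unanimity in \<open>pref\<close> is vacuous, but then there
    is only one profile and the range is a singleton.\<close>
  have "n \<noteq> 0"
  proof
    assume "n = 0"
    then have "X = f ` {\<lambda>i. undefined}" using onto by (simp add: rule_range_def profiles_def)
    then show False using two by blast
  qed
  then have "1 \<in> {1..n}" by simp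
  then have xy: "x \<noteq> f R" using pref strictly_prefers_asym by blast
  text \<open>\<open>q\<close> ranks above \<^term>\<open>f R\<close> only the points from \<^term>\<open>x\<close> up to
    \<^term>\<open>f R\<close>, which the peaked agents prefer to \<^term>\<open>f R\<close> already in \<^term>\<open>R\<close>; so
    the outcome is unchanged.\<close>
  define q where "q = peak_pref X (sgn (f R - x)) x"
  have "q \<in> single_peaked_prefs X"
    unfolding q_def using xy xX by (intro peak_pref_single_peaked) (auto simp: sgn_if)
  then have q: "peaked_part X n A (\<lambda>_. q)" by (rule peaked_part_const)
  define R1 where "R1 = split_profile n A (\<lambda>_. q) R"
  define R2 where "R2 = split_profile n A (\<lambda>_. q) R'"
  have R1: "R1 \<in> profiles X n A"
    unfolding R1_def using q parts(2) by (rule split_profile_in)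
  \<comment> \<open>As \<open>x\<close> is the top of \<open>q\<close>, letting the peaked agents of
    \<open>R'\<close> adopt \<open>q\<close> cannot move the outcome away from
    \<open>x\<close>.\<close>
  have "\<not> strictly_prefers q t x" for t
    unfolding q_def strictly_prefers_peak by auto
  then have R2x: "f R2 = x"
    using peaked_switch_from[OF q parts(3,4)] R' split_profile_self[OF R'(1)]
    unfolding R2_def by auto
  have R1y: "f R1 = f R"
  proof (rule ccontr)
    assume ne: "f R1 \<noteq> f R"
    have "strictly_prefers q (f R1) (f R)"
      using peaked_switch_from[OF q parts(1,2)] ne split_profile_self[OF R]
      unfolding R1_def by auto
    then have btw: "f R1 = x \<or> f R < f R1 \<and> f R1 < x \<or> x < f R1 \<and> f R1 < f R"
      unfolding q_def strictly_prefers_peak by (auto simp: sgn_if split: if_splits)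
    \<comment> \<open>This \<open>j\<close> loses by the switch and ranks \<open>x\<close> above
      \<open>f R\<close>, so \<open>f R1\<close> would be a middle point that \<open>j\<close> ranks
      below both.\<close>
    obtain j where j: "j \<in> {1..n} \<inter> A" "strictly_prefers (R j) (f R) (f R1)"
      using peaked_switch_from[OF parts(1) q parts(2)] ne split_profile_self[OF R]
      unfolding R1_def by auto
    have xPy: "strictly_prefers (R j) x (f R)" using j pref by blast
    have "strictly_prefers (R j) x (f R1)"
      using strictly_prefers_trans[OF linear[OF R] xPy j(2)] j(1) by blast
    moreover have "f R1 \<noteq> x" using xPy j(2) strictly_prefers_asym by blast
    ultimately show False
      using single_peaked_middle[OF profiles_peaked[OF R j(1)] xX outcome_in[OF R1] yX] btw j(2)
      by blast
  qed
  \<comment> \<open>From \<open>R1\<close> to \<open>R2\<close> only dipped agents move and the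
    outcome goes from \<open>f R\<close> to \<open>x\<close>, so one of them must rank
    \<open>f R\<close> above \<open>x\<close>.\<close>
  obtain j where "j \<in> {1..n} - A" "strictly_prefers (R j) (f R) x"
    using dipped_switch_from[OF q parts(2,4)] R1y R2x xy unfolding R1_def R2_def by auto
  then show False using pref strictly_prefers_asym by blast
qed

section \<open>Ranges that omit an alternative\<close>

lemma peaked_switch_common:
  assumes "q \<in> single_peaked_prefs X" "peaked_part X n A Q" "dipped_part X n A R"
    and "f (split_profile n A (\<lambda>_. q) R) \<noteq> f (split_profile n A Q R)"
  shows "strictly_prefers q (f (split_profile n A (\<lambda>_. q) R)) (f (split_profile n A Q R))"
  using peaked_switch_from[OF peaked_part_const[OF assms(1)] assms(2-4)] by simp

lemma dipped_switch_common:
  assumes "peaked_part X n A Q" "d \<in> single_dipped_prefs X" "dipped_part X n A R"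
    and "f (split_profile n A Q (\<lambda>_. d)) \<noteq> f (split_profile n A Q R)"
  shows "strictly_prefers d (f (split_profile n A Q (\<lambda>_. d))) (f (split_profile n A Q R))"
  using dipped_switch_from[OF assms(1) dipped_part_const[OF assms(2)] assms(3,4)] by simp

text \<open>One conclusion rules out the deviation to \<open>r\<close> as a gain, the other the
  deviation back; since the outcomes differ, not better means worse.\<close>

lemma update_changes_outcome:
  assumes R: "R \<in> profiles X n A" and i: "i \<in> {1..n}" and r: "r \<in> admissible_prefs X A i"
    and ne: "f (R(i := r)) \<noteq> f R"
  shows "strictly_prefers (R i) (f R) (f (R(i := r)))" "strictly_prefers r (f (R(i := r))) (f R)"
proof -
  have R1: "R(i := r) \<in> profiles X n A" using R i r by (rule profiles_update)
  have "\<not> strictly_prefers ((R(i := r)) i) (f ((R(i := r))(i := R i))) (f (R(i := r)))"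
    by (rule no_manipulation[OF R1 i profiles_admissible[OF R i]])
  then have "\<not> strictly_prefers r (f R) (f (R(i := r)))" by simp
  then show "strictly_prefers r (f (R(i := r))) (f R)"
    using linear_strictly_prefers_total[OF admissible_linear[OF r] outcome_in[OF R1] outcome_in[OF R] ne]
    by blast
  show "strictly_prefers (R i) (f R) (f (R(i := r)))"
    using linear_strictly_prefers_total[OF linear[OF R i] outcome_in[OF R1] outcome_in[OF R] ne]
      no_manipulation[OF R i r] by blast
qed

text \<open>First every dipped agent is given one of two fixed preferences without losing the outcome
  \<open>y\<close>. The two resulting blocks behave like two agents, and each of them can enforce an outcome on
  its own side of \<open>y\<close>.\<close>

lemma dipped_range_no_middle:
  assumes Q: "peaked_part X n A Q"
    and R: "dipped_part X n A R" "dipped_part X n A R'" "dipped_part X n A R''"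
    and less: "f (split_profile n A Q R') < f (split_profile n A Q R)"
      "f (split_profile n A Q R) < f (split_profile n A Q R'')"
  shows False
proof -
  define g where "g S = f (split_profile n A Q S)" for S
  define a y b where "a = g R'" and "y = g R" and "b = g R''"
  have ay: "a < y" and yb: "y < b" using less by (simp_all add: a_def y_def b_def g_def)
  have prof: "split_profile n A Q S \<in> profiles X n A" if "dipped_part X n A S" for S
    using Q that by (rule split_profile_in)
  have gX: "g S \<in> X" if "dipped_part X n A S" for S
    unfolding g_def by (rule outcome_in[OF prof[OF that]])
  have X: "a \<in> X" "y \<in> X" "b \<in> X" using gX R by (auto simp: a_def y_def b_def)
  \<comment> \<open>From \<open>a\<close> upwards \<open>inc\<close> increases, and from
    \<open>b\<close> downwards \<open>dec\<close> improves to the left. Both \<open>eR\<close> and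
    \<open>eL\<close> have their dip at \<open>y\<close>, so \<open>y\<close> is their worst point;
    they put the right and the left side first, respectively.\<close>
  define inc dec eR eL where "inc = dip_pref X 1 a" and "dec = dip_pref X (- 1) b"
    and "eR = dip_pref X 1 y" and "eL = dip_pref X (- 1) y"
  have dp: "inc \<in> single_dipped_prefs X" "dec \<in> single_dipped_prefs X"
      "eR \<in> single_dipped_prefs X" "eL \<in> single_dipped_prefs X"
    unfolding inc_def dec_def eR_def eL_def using X by (auto intro: dip_pref_single_dipped)
  have "\<exists>T. dipped_part X n A T \<and> (\<forall>i\<in>S. T i = inc \<or> T i = dec) \<and> g T = y"
    if "finite S" "S \<subseteq> {1..n} - A" for S
    using that
  proof (induction S rule: finite_induct)
    case empty
    then show ?case using R by (auto simp: y_def)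
  next
    case (insert i S)
    then obtain T where T: "dipped_part X n A T" "\<forall>i\<in>S. T i = inc \<or> T i = dec" "g T = y" by blast
    have i: "i \<in> {1..n}" "i \<notin> A" using insert.prems by auto
    have upd: "split_profile n A Q (T(i := r)) = (split_profile n A Q T)(i := r)" for r
      using i by (auto simp: split_profile_def fun_eq_iff)
    have part: "dipped_part X n A (T(i := r))" if "r \<in> single_dipped_prefs X" for r
      using T(1) that by (auto simp: dipped_part_def)
    have change: "strictly_prefers (T i) y (g (T(i := r))) \<and> strictly_prefers r (g (T(i := r))) y"
      if r: "r \<in> single_dipped_prefs X" and ne: "g (T(i := r)) \<noteq> y" for r
      using update_changes_outcome[OF prof[OF T(1)] i(1), of r] r ne i T(3)
      by (simp add: g_def upd admissible_prefs_def split_profile_apply)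
    \<comment> \<open>If both replacements failed, \<open>inc\<close> would lead above
      \<open>y\<close> and \<open>dec\<close> below it, with \<open>T i\<close> ranking the middle
      point \<open>y\<close> above both.\<close>
    have "g (T(i := inc)) = y \<or> g (T(i := dec)) = y"
    proof (rule ccontr)
      assume "\<not> ?thesis"
      then have *: "strictly_prefers (T i) y (g (T(i := inc)))" "strictly_prefers inc (g (T(i := inc))) y"
        "strictly_prefers (T i) y (g (T(i := dec)))" "strictly_prefers dec (g (T(i := dec))) y"
        using change dp by blast+
      have "y < g (T(i := inc))" "g (T(i := dec)) < y"
        using *(2,4) ay yb by (auto simp: inc_def dec_def strictly_prefers_dip)
      moreover have "T i \<in> single_dipped_prefs X"
        using T(1) i by (auto simp: dipped_part_def)
      ultimately show False
        using single_dipped_middle[of "T i" X "g (T(i := dec))" y "g (T(i := inc))"] * gX part dp X(2)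
        by blast
    qed
    then obtain e where e: "e = inc \<or> e = dec" "g (T(i := e)) = y" by blast
    show ?case
    proof (intro exI conjI)
      show "dipped_part X n A (T(i := e))" using e(1) part dp by blast
      show "\<forall>j\<in>insert i S. (T(i := e)) j = inc \<or> (T(i := e)) j = dec" using e(1) T(2) by simp
    qed (rule e(2))
  qed
  from this[of "{1..n} - A"] obtain T where T: "dipped_part X n A T"
    "\<forall>i\<in>{1..n} - A. T i = inc \<or> T i = dec" "g T = y" by auto
  \<comment> \<open>The block of \<open>dec\<close> holders now plays \<open>l\<close>, all other
    dipped agents play \<open>m\<close>.\<close>
  define h where "h l m = g (\<lambda>i. if T i = dec then l else m)" for l m
  have part: "dipped_part X n A (\<lambda>i. if T i = dec then l else m)"
    if "l \<in> single_dipped_prefs X" "m \<in> single_dipped_prefs X" for l m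
    using that by (simp add: dipped_part_def)
  have left: "strictly_prefers l (h l m) (h l' m)"
    if "l \<in> single_dipped_prefs X" "m \<in> single_dipped_prefs X" "l' \<in> single_dipped_prefs X"
      "h l m \<noteq> h l' m" for l m l'
    unfolding h_def g_def
  proof (rule common_pref_coalition[OF prof[OF part] prof[OF part], of l m l' m "{i. i \<notin> A \<and> T i = dec}"])
    show "{i. i \<notin> A \<and> T i = dec} \<subseteq> A \<or> {i. i \<notin> A \<and> T i = dec} \<inter> A = {}" by blast
    show "f (split_profile n A Q (\<lambda>i. if T i = dec then l else m)) \<noteq>
        f (split_profile n A Q (\<lambda>i. if T i = dec then l' else m))"
      using that(4) by (simp only: h_def g_def not_False_eq_True)
  qed (use that in \<open>auto simp: split_profile_apply\<close>)
  have right: "strictly_prefers m (h l m) (h l m')"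
    if "l \<in> single_dipped_prefs X" "m \<in> single_dipped_prefs X" "m' \<in> single_dipped_prefs X"
      "h l m \<noteq> h l m'" for l m m'
    unfolding h_def g_def
  proof (rule common_pref_coalition[OF prof[OF part] prof[OF part], of l m l m' "{i. i \<notin> A \<and> T i \<noteq> dec}"])
    show "{i. i \<notin> A \<and> T i \<noteq> dec} \<subseteq> A \<or> {i. i \<notin> A \<and> T i \<noteq> dec} \<inter> A = {}" by blast
    show "f (split_profile n A Q (\<lambda>i. if T i = dec then l else m)) \<noteq>
        f (split_profile n A Q (\<lambda>i. if T i = dec then l else m'))"
      using that(4) by (simp only: h_def g_def not_False_eq_True)
  qed (use that in \<open>auto simp: split_profile_apply\<close>)
  have "split_profile n A Q (\<lambda>i. if T i = dec then dec else inc) = split_profile n A Q T"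
    unfolding split_profile_def by (rule restrict_ext) (use T(2) in auto)
  then have di: "h dec inc = y" using T(3) by (simp add: h_def g_def)
  have dd: "h dec dec \<le> a"
  proof (cases "h dec dec = a")
    case False
    then have "strictly_prefers dec (h dec dec) a"
      using dipped_switch_common[OF Q dp(2) R(2)] by (simp add: h_def g_def a_def)
    then show ?thesis using ay yb by (auto simp: dec_def strictly_prefers_dip)
  qed simp
  have ii: "b \<le> h inc inc"
  proof (cases "h inc inc = b")
    case False
    then have "strictly_prefers inc (h inc inc) b"
      using dipped_switch_common[OF Q dp(1) R(3)] by (simp add: h_def g_def b_def)
    then show ?thesis using ay yb by (auto simp: inc_def strictly_prefers_dip)
  qed simp
  \<comment> \<open>At outcome \<open>y\<close>, the worst for \<open>eR\<close>, the second block
    would gain by playing \<open>dec\<close>; if the outcome were above \<open>y\<close>, that block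
    would gain at \<open>h dec inc\<close> by playing \<open>eR\<close>.\<close>
  have dR: "h dec eR < y"
  proof (rule ccontr)
    assume not: "\<not> h dec eR < y"
    show False
    proof (cases "h dec eR = y")
      case True
      then show False
        using right[OF dp(2,3,2)] dd ay by (auto simp: eR_def strictly_prefers_dip)
    next
      case False
      then show False
        using right[OF dp(2,1,3)] not di ay by (auto simp: inc_def strictly_prefers_dip)
    qed
  qed
  have Li: "y < h eL inc"
  proof (rule ccontr)
    assume not: "\<not> y < h eL inc"
    show False
    proof (cases "h eL inc = y")
      case True
      then show False
        using left[OF dp(4,1,1)] ii yb by (auto simp: eL_def strictly_prefers_dip)
    next
      case False
      then show False
        using left[OF dp(2,1,4)] not di yb by (auto simp: dec_def strictly_prefers_dip)
    qed
  qed
  \<comment> \<open>By imitating \<open>dec\<close> the first block can force an outcome below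
    \<open>y\<close>, and by imitating \<open>inc\<close> the second can force one above
    \<open>y\<close>; at \<open>h eL eR\<close> each must get its side.\<close>
  have "h eL eR < y"
  proof (cases "h eL eR = h dec eR")
    case False
    then show ?thesis
      using left[OF dp(4,3,2)] dR by (auto simp: eL_def strictly_prefers_dip)
  qed (use dR in simp)
  moreover have "y < h eL eR"
  proof (cases "h eL eR = h eL inc")
    case False
    then show ?thesis
      using right[OF dp(4,3,1)] Li by (auto simp: eR_def strictly_prefers_dip)
  qed (use Li in simp)
  ultimately show False by simp
qed

section \<open>Where an efficient rule can omit an alternative\<close>

lemma range_attained:
  assumes "x \<in> rule_range X n A f"
  obtains R where "R \<in> profiles X n A" "f R = x"
  using assms unfolding rule_range_def by blast

text \<open>With peaks at \<open>x\<close> and dips at \<open>c\<close> oriented towards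
  \<open>x\<close>, every agent ranks \<open>x\<close> above the whole range.\<close>

lemma not_efficient_beyond_range:
  assumes PE: "pareto_efficient X n A f" and s: "s = 1 \<or> s = - 1" and x: "x \<in> X"
    and c: "c \<in> rule_range X n A f" and beyond: "\<And>t. t \<in> rule_range X n A f \<Longrightarrow> s * t < s * x"
  shows False
proof -
  have sub: "t \<in> X" if "t \<in> rule_range X n A f" for t
    using that outcome_in by (metis range_attained)
  define R where "R = split_profile n A (\<lambda>_. peak_pref X s x) (\<lambda>_. dip_pref X s c)"
  have R: "R \<in> profiles X n A"
    unfolding R_def using s x sub[OF c]
    by (intro split_profile_in peaked_part_const dipped_part_const peak_pref_single_peaked
        dip_pref_single_dipped)
  have "f R \<in> rule_range X n A f" unfolding rule_range_def using R by (rule imageI)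
  then have "strictly_prefers (R i) x (f R)" if "i \<in> {1..n}" for i
    using that beyond[of "f R"] beyond[OF c] x sub
    by (auto simp: R_def split_profile_apply strictly_prefers_peak strictly_prefers_dip)
  then show False using PE R x unfolding pareto_efficient_def by blast
qed

text \<open>When all peaked agents hold \<open>peak_pref X s r\<close>, the dipped agents can reach
  a point behind \<open>x\<close>, the point \<open>r\<close>, and a point beyond \<open>r\<close>,
  contradicting \<open>dipped_range_no_middle\<close>.\<close>

lemma not_efficient_gap:
  assumes PE: "pareto_efficient X n A f" and s: "s = 1 \<or> s = - 1"
    and x: "x \<in> X" "x \<notin> rule_range X n A f"
    and r: "r \<in> rule_range X n A f" and w: "w \<in> rule_range X n A f"
    and xr: "s * x < s * r" and rw: "s * r < s * w"
  shows False
proof -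
  obtain R1 where R1: "R1 \<in> profiles X n A" "f R1 = r" using r by (rule range_attained)
  obtain R2 where R2: "R2 \<in> profiles X n A" "f R2 = w" using w by (rule range_attained)
  have X: "r \<in> X" "w \<in> X" using R1 R2 outcome_in by auto
  have s': "- s = 1 \<or> - s = - 1" using s by auto
  define to away where "to = dip_pref X s r" and "away = dip_pref X (- s) r"
  have d: "to \<in> single_dipped_prefs X" "away \<in> single_dipped_prefs X"
    unfolding to_def away_def using X s s' by (auto intro: dip_pref_single_dipped)
  note dpart = dipped_part_const[OF d(1), of n A] dipped_part_const[OF d(2), of n A]
  define F where "F z R = f (split_profile n A (\<lambda>_. peak_pref X s z) R)" for z R
  have pk: "peak_pref X s z \<in> single_peaked_prefs X" if "z \<in> X" for z
    using s that by (rule peak_pref_single_peaked)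
  note pp = peaked_part_const[OF pk]
  have switch: "strictly_prefers (peak_pref X s z) (F z R) (F z' R)"
    if "z \<in> X" "z' \<in> X" "dipped_part X n A R" "F z R \<noteq> F z' R" for z z' R
    using peaked_switch_common[OF pk[OF that(1)] pp[OF that(2)] that(3)] that(4) by (simp add: F_def)
  have dswitch: "strictly_prefers e (F z (\<lambda>_. e)) (F z R)"
    if "z \<in> X" "e \<in> single_dipped_prefs X" "dipped_part X n A R" "F z (\<lambda>_. e) \<noteq> F z R" for z e R
    using dipped_switch_common[OF pp[OF that(1)] that(2,3)] that(4) by (simp add: F_def)
  have own: "F (f R) R = f R" if R: "R \<in> profiles X n A" for R
  proof (rule ccontr)
    assume "F (f R) R \<noteq> f R"
    then have "strictly_prefers (peak_pref X s (f R)) (F (f R) R) (f R)"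
      using peaked_switch_common[OF pk[OF outcome_in[OF R]] peaked_part_profile[OF R]
          dipped_part_profile[OF R]] split_profile_self[OF R] by (simp add: F_def)
    then show False by (auto simp: strictly_prefers_peak)
  qed
  \<comment> \<open>An outcome beyond \<open>x\<close> would be dominated by \<open>x\<close>: it is
    the peak of the peaked agents, and \<open>away\<close> ranks \<open>x\<close> above everything
    beyond it.\<close>
  have xaway: "s * F x (\<lambda>_. away) < s * x"
  proof -
    let ?R = "split_profile n A (\<lambda>_. peak_pref X s x) (\<lambda>_. away)"
    have R: "?R \<in> profiles X n A" using pp[OF x(1)] dpart(2) by (rule split_profile_in)
    obtain i where i: "i \<in> {1..n}" "\<not> strictly_prefers (?R i) x (f ?R)"
      using PE R x(1) unfolding pareto_efficient_def by blast
    have "f ?R \<in> rule_range X n A f" unfolding rule_range_def using R by (rule imageI)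
    then have "f ?R \<noteq> x" using x(2) by auto
    then have "s * f ?R \<noteq> s * x" using s by auto
    moreover have "s * f ?R \<le> s * x \<or> s * f ?R = s * x"
      using i x outcome_in[OF R] calculation xr
      by (cases "i \<in> A")
        (auto simp: split_profile_apply strictly_prefers_peak strictly_prefers_dip away_def)
    ultimately show ?thesis unfolding F_def by linarith
  qed
  \<comment> \<open>Moving the peaks from \<open>x\<close> to \<open>r\<close> must not help the
    agents with peak \<open>x\<close>, so the outcome can only recede further behind
    \<open>x\<close>.\<close>
  have raway: "s * F r (\<lambda>_. away) < s * x"
    using switch[OF x(1) X(1) dpart(2)] xaway
    by (cases "F x (\<lambda>_. away) = F r (\<lambda>_. away)") (auto simp: strictly_prefers_peak)
  have wto: "s * w \<le> s * F w (\<lambda>_. to)"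
    using dswitch[OF X(2) d(1) dipped_part_profile[OF R2(1)]] own[OF R2(1)] R2(2) rw
    by (cases "F w (\<lambda>_. to) = w") (auto simp: strictly_prefers_dip to_def)
  \<comment> \<open>Outcome \<open>r\<close> is the worst for \<open>to\<close>, and
    \<open>away\<close> would avoid it. An outcome behind \<open>r\<close> is ranked by
    \<open>peak_pref X s r\<close> below the one beyond \<open>r\<close> that announcing peak
    \<open>w\<close> yields.\<close>
  have rto: "s * r < s * F r (\<lambda>_. to)"
  proof (rule ccontr)
    assume not: "\<not> ?thesis"
    show False
    proof (cases "F r (\<lambda>_. to) = r")
      case True
      then show False
        using dswitch[OF X(1) d(1) dpart(2)] raway xr
        by (cases "F r (\<lambda>_. away) = r") (auto simp: strictly_prefers_dip to_def)
    next
      case False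
      then have "s * F r (\<lambda>_. to) \<noteq> s * r" using s by auto
      then show False
        using switch[OF X dpart(1)] wto not rw
        by (cases "F r (\<lambda>_. to) = F w (\<lambda>_. to)") (auto simp: strictly_prefers_peak)
    qed
  qed
  have mid: "F r R1 = r" using own[OF R1(1)] R1(2) by simp
  note no_middle = dipped_range_no_middle[OF pp[OF X(1)] dipped_part_profile[OF R1(1)]]
  from s show False
  proof
    assume "s = 1"
    then show False
      using no_middle[OF dpart(2,1)] raway rto xr mid by (simp add: F_def)
  next
    assume "s = - 1"
    then show False
      using no_middle[OF dpart(1,2)] raway rto xr mid by (simp add: F_def)
  qed
qed

text \<open>An omitted alternative has points of the range on both sides, and exactly one on each.
  Every further omitted alternative then also lies between these two points, which makes them the
  extremes.\<close>

lemma efficient_imp_onto_or_extremes: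
  assumes PE: "pareto_efficient X n A f" and range: "rule_range X n A f \<noteq> {}"
    and not_onto: "rule_range X n A f \<noteq> X"
  shows "\<exists>m M. is_min X m \<and> is_max X M \<and> rule_range X n A f = {m, M}"
proof -
  let ?O = "rule_range X n A f"
  have sub: "?O \<subseteq> X" using outcome_in by (auto simp: rule_range_def)
  then obtain x where x: "x \<in> X" "x \<notin> ?O" using not_onto by blast
  obtain c where c: "c \<in> ?O" using range by blast
  have above: "\<exists>t\<in>?O. u < t" if u: "u \<in> X" "u \<notin> ?O" for u
  proof (rule ccontr)
    assume "\<not> ?thesis"
    then have "t < u" if "t \<in> ?O" for t
      using that u(2) by (cases t u rule: linorder_cases) auto
    then show False
      by (intro not_efficient_beyond_range[OF PE disjI1[OF refl] u(1) c]) simp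
  qed
  have below: "\<exists>t\<in>?O. t < u" if u: "u \<in> X" "u \<notin> ?O" for u
  proof (rule ccontr)
    assume "\<not> ?thesis"
    then have "u < t" if "t \<in> ?O" for t
      using that u(2) by (cases t u rule: linorder_cases) auto
    then show False
      by (intro not_efficient_beyond_range[OF PE disjI2[OF refl] u(1) c]) simp
  qed
  obtain l r where lr: "l \<in> ?O" "l < x" "r \<in> ?O" "x < r" using above[OF x] below[OF x] by blast
  have right: "w = r" if w: "w \<in> ?O" "x < w" for w
  proof (rule ccontr)
    assume "w \<noteq> r"
    then have "r < w \<or> w < r" by linarith
    then show False
      using not_efficient_gap[OF PE _ x lr(3) w(1), of 1] not_efficient_gap[OF PE _ x w(1) lr(3), of 1]
        lr(4) w(2) by auto
  qed
  have left: "w = l" if w: "w \<in> ?O" "w < x" for w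
  proof (rule ccontr)
    assume "w \<noteq> l"
    then have "w < l \<or> l < w" by linarith
    then show False
      using not_efficient_gap[OF PE _ x lr(1) w(1), of "- 1"]
        not_efficient_gap[OF PE _ x w(1) lr(1), of "- 1"] lr(2) w(2) by auto
  qed
  have eq: "?O = {l, r}"
  proof
    show "?O \<subseteq> {l, r}"
    proof
      fix w assume w: "w \<in> ?O"
      then have "w < x \<or> x < w" using x(2) by (cases w x rule: linorder_cases) auto
      then show "w \<in> {l, r}" using left[OF w] right[OF w] by blast
    qed
  qed (use lr in simp)
  have "u \<le> r" if u: "u \<in> X" for u
  proof (cases "u \<in> ?O")
    case False
    then show ?thesis using above[OF u] lr unfolding eq by auto
  qed (use lr in \<open>auto simp: eq\<close>)
  then have "is_max X r" using sub lr(3) by (auto simp: is_max_def)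
  moreover have "l \<le> u" if u: "u \<in> X" for u
  proof (cases "u \<in> ?O")
    case False
    then show ?thesis using below[OF u] lr unfolding eq by auto
  qed (use lr in \<open>auto simp: eq\<close>)
  then have "is_min X l" using sub lr(1) by (auto simp: is_min_def)
  ultimately show ?thesis using eq by blast
qed

section \<open>Ranges consisting of the two extremes\<close>

text \<open>Passing from \<open>R\<close> to \<open>R'\<close> one agent at a time, some agent is
  pivotal; with only two values the outcome then jumps directly to \<open>f R'\<close>, and
  \<open>update_changes_outcome\<close> gives both rankings.\<close>

lemma two_valued_switch:
  assumes two: "rule_range X n A f = {m, M}"
    and R: "R \<in> profiles X n A" and R': "R' \<in> profiles X n A" and ne: "f R \<noteq> f R'"
  shows "\<exists>i\<in>{1..n}. strictly_prefers (R i) (f R) (f R') \<and> strictly_prefers (R' i) (f R') (f R)"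
proof -
  have val: "f S = m \<or> f S = M" if "S \<in> profiles X n A" for S
    using two that unfolding rule_range_def by blast
  have "\<exists>i\<in>{1..n}. strictly_prefers (R i) (f R) (f R') \<and> strictly_prefers (R' i) (f R') (f R)"
    if "finite C" "C \<subseteq> {1..n}" "\<And>i. i \<in> {1..n} - C \<Longrightarrow> R i = R' i" "R \<in> profiles X n A" "f R \<noteq> f R'"
    for C R
    using that
  proof (induction C arbitrary: R rule: finite_induct)
    case empty
    then show ?case using profiles_eqI[OF empty.prems(3) R'] by auto
  next
    case (insert i C)
    note R = insert.prems(3) and ne = insert.prems(4)
    have i: "i \<in> {1..n}" using insert.prems(1) by simp
    have adm: "R' i \<in> admissible_prefs X A i" by (rule profiles_admissible[OF R' i])
    define S where "S = R(i := R' i)"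
    have S: "S \<in> profiles X n A" unfolding S_def using R i adm by (rule profiles_update)
    show ?case
    proof (cases "f S = f R")
      case True
      have "\<exists>j\<in>{1..n}. strictly_prefers (S j) (f S) (f R') \<and> strictly_prefers (R' j) (f R') (f S)"
      proof (rule insert.IH[OF _ _ S])
        show "S k = R' k" if "k \<in> {1..n} - C" for k
          using insert.prems(2)[of k] that by (cases "k = i") (auto simp: S_def)
      qed (use insert.prems(1) ne True in auto)
      then obtain j where j: "j \<in> {1..n}" "strictly_prefers (S j) (f R) (f R')"
        "strictly_prefers (R' j) (f R') (f R)" unfolding True by blast
      \<comment> \<open>Since \<open>S i\<close> is \<open>R' i\<close>, agent \<open>i\<close>
        cannot rank the two outcomes in opposite ways in \<open>S\<close> and
        \<open>R'\<close>.\<close>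
      then have "j \<noteq> i" using strictly_prefers_asym[OF j(3)] by (auto simp: S_def)
      then show ?thesis using j by (auto simp: S_def)
    next
      case False
      then have "f S = f R'" using val[OF S] val[OF R] val[OF R'] ne by metis
      then show ?thesis
        using update_changes_outcome[OF R i adm] False i by (auto simp: S_def)
    qed
  qed
  from this[of "{1..n}"] show ?thesis using R ne by simp
qed

lemma best_in_pair:
  assumes "strictly_prefers r u v" "linear_order_on X r" "u \<in> X"
  shows "best_in {u, v} r = u"
  unfolding best_in_def
proof (rule the_equality)
  have "(u, u) \<in> r"
    using assms(2,3) by (auto simp: linear_order_on_def partial_order_on_def preorder_on_def refl_on_def)
  then show "u \<in> {u, v} \<and> (\<forall>y\<in>{u, v}. (u, y) \<in> r)"
    using assms(1) by (auto simp: strictly_prefers_def)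
  show "z = u" if "z \<in> {u, v} \<and> (\<forall>y\<in>{u, v}. (z, y) \<in> r)" for z
    using that assms(1) by (auto simp: strictly_prefers_def)
qed

text \<open>An interior point that beats one extreme must lose to the other; transitivity compares
  the extremes.\<close>

lemma single_dipped_other_extreme:
  assumes r: "r \<in> single_dipped_prefs X" and m: "is_min X m" and M: "is_max X M"
    and uv: "{u, v} = {m, M}" and x: "x \<in> X" "strictly_prefers r x u"
  shows "strictly_prefers r v u"
proof (cases "x = v")
  case False
  have lin: "linear_order_on X r" using r by (simp add: single_dipped_prefs_def)
  have X: "u \<in> X" "v \<in> X" using m M uv by (auto simp: is_min_def is_max_def doubleton_eq_iff)
  have "x \<noteq> u" using x(2) by (auto simp: strictly_prefers_def)
  then have "u < x \<and> x < v \<or> v < x \<and> x < u"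
    using m M uv x(1) False by (auto simp: is_min_def is_max_def doubleton_eq_iff order.strict_iff_order)
  then have "\<not> strictly_prefers r x v"
    using single_dipped_middle[OF r X(1) x(1) X(2)] x(2) by blast
  then have "strictly_prefers r v x"
    using linear_strictly_prefers_total[OF lin X(2) x(1)] False by blast
  then show ?thesis using strictly_prefers_trans[OF lin] x(2) by blast
qed (use x(2) in simp)

lemma efficient_extremes_iff:
  assumes A_sub: "A \<subseteq> {1..n}" and m: "is_min X m" and M: "is_max X M"
    and two: "rule_range X n A f = {m, M}"
    and mM: "m \<noteq> M" and not_onto: "rule_range X n A f \<noteq> X"
  shows "pareto_efficient X n A f \<longleftrightarrow> A = {} \<or> range_omega X n A f = {{m, M}}"
proof
  have mX: "m \<in> X" and MX: "M \<in> X" and lt: "m < M"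
    using m M mM by (auto simp: is_min_def is_max_def order.strict_iff_order)
  have val: "f S = m \<or> f S = M" if "S \<in> profiles X n A" for S
    using two that unfolding rule_range_def by blast
  {
    assume PE: "pareto_efficient X n A f"
    obtain x where x: "x \<in> X" "m < x" "x < M"
      using not_onto mX MX m M unfolding two is_min_def is_max_def
      by (auto simp: order.strict_iff_order)
    have "omega X n A f p = {m, M}" if p: "p \<in> A \<rightarrow>\<^sub>E {m, M}" for p
    proof -
      \<comment> \<open>All peaks are at the interior point \<open>x\<close>, while the orientation
        makes \<open>p i\<close> the better of the two extremes.\<close>
      define Q where "Q i = peak_pref X (if p i = M then 1 else - 1) x" for i
      have Q: "Q i \<in> single_peaked_prefs X" for i
        unfolding Q_def using x(1) by (intro peak_pref_single_peaked) auto
      then have Qpart: "peaked_part X n A Q" by (simp add: peaked_part_def)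
      have x_top: "strictly_prefers (Q i) x u" if "u \<in> {m, M}" for i u
        using that x mX MX by (auto simp: Q_def strictly_prefers_peak)
      have best: "best_in {m, M} (Q i) = p i" if "i \<in> A" for i
      proof -
        have lin: "linear_order_on X (Q i)" using Q by (simp add: single_peaked_prefs_def)
        have "p i \<in> {m, M}" using p that by (rule PiE_mem)
        then consider "p i = M" | "p i = m" "p i \<noteq> M" using mM by blast
        then show ?thesis
        proof cases
          case 1
          then have "strictly_prefers (Q i) M m"
            using x mX MX by (auto simp: Q_def strictly_prefers_peak)
          then show ?thesis using best_in_pair[OF _ lin MX, of m] 1 insert_commute[of M m "{}"] by simp
        next
          case 2
          then have "strictly_prefers (Q i) m M"
            using x mX MX by (auto simp: Q_def strictly_prefers_peak)
          then show ?thesis using best_in_pair[OF _ lin mX] 2 by simp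
        qed
      qed
      have attained: "u \<in> omega X n A f p"
        if d: "d \<in> single_dipped_prefs X" and xd: "strictly_prefers d x v" and uv: "{u, v} = {m, M}"
        for d u v
      proof -
        let ?R = "split_profile n A Q (\<lambda>_. d)"
        have R: "?R \<in> profiles X n A" using Qpart dipped_part_const[OF d] by (rule split_profile_in)
        \<comment> \<open>Outcome \<open>v\<close> would be dominated by \<open>x\<close>, so
          efficiency forces the other extreme \<open>u\<close>.\<close>
        obtain i where i: "i \<in> {1..n}" "\<not> strictly_prefers (?R i) x (f ?R)"
          using PE R x(1) unfolding pareto_efficient_def by blast
        have "f ?R \<noteq> v"
          using i xd x_top[of v i] uv by (auto simp: split_profile_apply split: if_splits)
        then have "f ?R = u" using val[OF R] uv by (auto simp: doubleton_eq_iff)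
        moreover have "peak_vector X n A f ?R = p"
        proof (rule PiE_ext)
          show "peak_vector X n A f ?R \<in> (\<Pi>\<^sub>E i\<in>A. UNIV)" by (simp add: peak_vector_def)
          show "p \<in> (\<Pi>\<^sub>E i\<in>A. UNIV)" using p by (auto simp: PiE_iff)
          show "peak_vector X n A f ?R i = p i" if "i \<in> A" for i
            using that A_sub best[OF that] by (auto simp: peak_vector_def two split_profile_apply subset_iff)
        qed
        ultimately show ?thesis using R uv unfolding omega_def two by blast
      qed
      have "strictly_prefers (dip_pref X 1 m) x m" "strictly_prefers (dip_pref X (- 1) M) x M"
        using x mX MX by (auto simp: strictly_prefers_dip)
      then have "M \<in> omega X n A f p" "m \<in> omega X n A f p"
        using attained[OF dip_pref_single_dipped[OF _ mX]] attained[OF dip_pref_single_dipped[OF _ MX]]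
        by blast+
      then show ?thesis unfolding omega_def two by blast
    qed
    moreover have "(A \<rightarrow>\<^sub>E {m, M}) \<noteq> {}" by (simp add: PiE_eq_empty_iff)
    ultimately show "A = {} \<or> range_omega X n A f = {{m, M}}"
      unfolding range_omega_def two by (simp add: image_constant_conv cong: image_cong)
  }
  assume rhs: "A = {} \<or> range_omega X n A f = {{m, M}}"
  show "pareto_efficient X n A f"
    unfolding pareto_efficient_def
  proof (rule ballI, rule notI)
    fix R assume R: "R \<in> profiles X n A"
      and "\<exists>x\<in>X. \<forall>i\<in>{1..n}. strictly_prefers (R i) x (f R)"
    then obtain x where x: "x \<in> X" and pref: "\<And>i. i \<in> {1..n} \<Longrightarrow> strictly_prefers (R i) x (f R)" by blast
    obtain v where uv: "{f R, v} = {m, M}" using val[OF R] by blast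
    have ne: "f R \<noteq> v" using uv mM by auto
    have dipped: "strictly_prefers (R i) v (f R)" if i: "i \<in> {1..n} - A" for i
      using single_dipped_other_extreme[OF profiles_dipped[OF R i] m M uv x] pref i by blast
    \<comment> \<open>The other extreme is reachable with unchanged peaks in the range: trivially
      without peaked agents, otherwise because \<open>omega\<close> takes only the value
      \<open>{m, M}\<close>.\<close>
    have "\<exists>R'\<in>profiles X n A. f R' = v \<and> (\<forall>i\<in>A. best_in {m, M} (R' i) = best_in {m, M} (R i))"
    proof (cases "A = {}")
      case True
      have "v \<in> rule_range X n A f" using uv two by blast
      then obtain R' where "R' \<in> profiles X n A" "f R' = v" by (rule range_attained)
      then show ?thesis using True by blast
    next
      case False
      have best: "best_in {m, M} (R i) \<in> {m, M}" if "i \<in> A" for i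
      proof -
        have i: "i \<in> {1..n}" using that A_sub by blast
        show ?thesis
          using linear_strictly_prefers_total[OF linear[OF R i] mX MX mM]
            best_in_pair[OF _ linear[OF R i] mX, of M] best_in_pair[OF _ linear[OF R i] MX, of m]
            insert_commute[of M m "{}"] by auto
      qed
      then have "peak_vector X n A f R \<in> A \<rightarrow>\<^sub>E {m, M}"
        unfolding peak_vector_def two by auto
      then have "omega X n A f (peak_vector X n A f R) = {m, M}"
        using rhs False unfolding range_omega_def two by blast
      then have "v \<in> omega X n A f (peak_vector X n A f R)" using uv by blast
      then obtain R' where R': "R' \<in> profiles X n A" "f R' = v"
        "peak_vector X n A f R' = peak_vector X n A f R" unfolding omega_def by blast
      have "best_in {m, M} (R' i) = best_in {m, M} (R i)" if "i \<in> A" for i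
        using fun_cong[OF R'(3), of i] that by (simp add: peak_vector_def two)
      then show ?thesis using R' by blast
    qed
    then obtain R' where R': "R' \<in> profiles X n A" "f R' = v"
      and best: "\<And>i. i \<in> A \<Longrightarrow> best_in {m, M} (R' i) = best_in {m, M} (R i)" by blast
    \<comment> \<open>The pivotal agent reverses its ranking of the extremes, which equal best
      elements forbid to a peaked agent; a dipped one ranks \<open>v\<close> above
      \<open>f R\<close> already in \<open>R\<close>.\<close>
    obtain i where i: "i \<in> {1..n}" "strictly_prefers (R i) (f R) v" "strictly_prefers (R' i) v (f R)"
      using two_valued_switch[OF two R R'(1)] R'(2) ne by blast
    have X: "f R \<in> X" "v \<in> X" using outcome_in[OF R] outcome_in[OF R'(1)] R'(2) by auto
    show False
    proof (cases "i \<in> A")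
      case True
      have "best_in {f R, v} (R i) = f R" using best_in_pair[OF i(2) linear[OF R i(1)] X(1)] .
      moreover have "best_in {v, f R} (R' i) = v" using best_in_pair[OF i(3) linear[OF R'(1) i(1)] X(2)] .
      ultimately show False using best[OF True] uv ne by (simp add: insert_commute)
    next
      case False
      then show False using dipped[of i] i strictly_prefers_asym by blast
    qed
  qed
qed

end

theorem proposition5:
  fixes X :: "real set" and n :: nat and A :: "nat set"
  assumes "A \<subseteq> {1..n}"
  shows "(\<forall>f. social_choice_rule X n A f \<and> strategy_proof X n A f \<and> rule_range X n A f = X
            \<longrightarrow> pareto_efficient X n A f)
       \<and> (\<forall>f. social_choice_rule X n A f \<and> strategy_proof X n A f \<and> rule_range X n A f \<noteq> X
              \<and> \<not> (\<exists>m M. is_min X m \<and> is_max X M \<and> rule_range X n A f = {m, M})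
            \<longrightarrow> \<not> pareto_efficient X n A f)
       \<and> (\<forall>f m M. social_choice_rule X n A f \<and> strategy_proof X n A f
              \<and> is_min X m \<and> is_max X M
              \<and> rule_range X n A f = {m, M} \<and> rule_range X n A f \<noteq> X
            \<longrightarrow> (pareto_efficient X n A f \<longleftrightarrow> A = {} \<or> range_omega X n A f = {{m, M}}))"
proof -
  have rule: "sp_rule X n A f" if "social_choice_rule X n A f" "strategy_proof X n A f" for f
    using that unfolding social_choice_rule_def by unfold_locales auto
  have two: "\<exists>x\<in>rule_range X n A f. \<exists>y\<in>rule_range X n A f. x \<noteq> y"
    if "social_choice_rule X n A f" for f
    using that unfolding social_choice_rule_def by (elim conjE)
  show ?thesis
  proof (intro conjI allI impI; elim conjE)
    fix f assume "social_choice_rule X n A f" "strategy_proof X n A f" "rule_range X n A f = X"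
    then show "pareto_efficient X n A f"
      using sp_rule.pareto_efficient_if_onto[OF rule] two by metis
  next
    fix f assume f: "social_choice_rule X n A f" "strategy_proof X n A f" and "rule_range X n A f \<noteq> X"
      and "\<not> (\<exists>m M. is_min X m \<and> is_max X M \<and> rule_range X n A f = {m, M})"
    then show "\<not> pareto_efficient X n A f"
      using sp_rule.efficient_imp_onto_or_extremes[OF rule[OF f]] two[OF f(1)] by blast
  next
    fix f m M assume f: "social_choice_rule X n A f" "strategy_proof X n A f"
      and *: "is_min X m" "is_max X M" "rule_range X n A f = {m, M}" "rule_range X n A f \<noteq> X"
    have "m \<noteq> M" using two[OF f(1)] *(3) by auto
    then show "pareto_efficient X n A f \<longleftrightarrow> A = {} \<or> range_omega X n A f = {{m, M}}"
      by (rule sp_rule.efficient_extremes_iff[OF rule[OF f] assms *(1-3) _ *(4)])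
  qed
qed

end
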